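(* Let $\lambda\ge\omega$ be a cardinal and let $k,r\in\omega$. Then every hypergraph $\mathcal E\subseteq[\lambda]^{\omega}$ (i.e. every edge is a countably infinite subset of $\lambda$) possessing property $C(r,k)$ has a minimal vertex cover.
   Context: A hypergraph is identified with a family $\mathcal E$ of non-empty sets (its edges); its vertex set is $\bigcup\mathcal E$. $[\lambda]^{\omega}$ denotes the set of subsets of $\lambda$ of cardinality exactly $\omega$. A hypergraph $\mathcal E$ possesses property $C(m,\rho)$ iff $|\bigcap\mathcal E'|<\rho$ for every set $\mathcal E'\subseteq\mathcal E$ of exactly $m$ distinct edges (so $C(r,k)$: any $r$ distinct edges have fewer than $k$ common elements). A set $Y\subseteq\bigcup\mathcal E$ is a vertex cover of $\mathcal E$ iff $Y\cap E\neq\emptyset$ for every $E\in\mathcal E$; it is a minimal vertex cover iff no proper subset of $Y$ is a vertex cover. *)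

theory Defs
  imports Main
begin

unbundle cardinal_syntax

definition hypergraph :: "'a set set \<Rightarrow> bool" where
  "hypergraph E \<longleftrightarrow> {} \<notin> E"

definition vertices :: "'a set set \<Rightarrow> 'a set" where
  "vertices E = \<Union>E"

(* The set of subsets of the cardinal lam of cardinality exactly omega. A cardinal is a relation
   satisfying Card_order (a well-order of minimal order type), and Field lam is its underlying
   set. *)
definition omega_subsets :: "'a rel \<Rightarrow> 'a set set" where
  "omega_subsets lam = {A. A \<subseteq> Field lam \<and> |A| =o natLeq}"

(* Property C(m, rho) for finite m and rho. The common elements are taken inside the vertex set.
   This matters only for m = 0, where the empty intersection is then the set of all vertices,
   independently of the ambient type. Finiteness is explicit because card is 0 on infinite sets. *)
definition property_C :: "nat \<Rightarrow> nat \<Rightarrow> 'a set set \<Rightarrow> bool" where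
  "property_C m \<rho> E \<longleftrightarrow>
     (\<forall>E'. E' \<subseteq> E \<and> finite E' \<and> card E' = m \<longrightarrow>
        finite (vertices E \<inter> \<Inter>E') \<and> card (vertices E \<inter> \<Inter>E') < \<rho>)"

definition vertex_cover :: "'a set set \<Rightarrow> 'a set \<Rightarrow> bool" where
  "vertex_cover E Y \<longleftrightarrow> Y \<subseteq> vertices E \<and> (\<forall>A\<in>E. Y \<inter> A \<noteq> {})"

definition minimal_vertex_cover :: "'a set set \<Rightarrow> 'a set \<Rightarrow> bool" where
  "minimal_vertex_cover E Y \<longleftrightarrow>
     vertex_cover E Y \<and> (\<forall>Z. Z \<subset> Y \<longrightarrow> \<not> vertex_cover E Z)"

end

theory Submission
  imports Defs "HOL-Library.Countable_Set_Type"
begin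

text \<open>A cover is minimal as soon as each of its points has a private edge, i.e. an edge meeting the
  cover in that point only. For countably many edges such a cover is built greedily: finitely many
  points and private edges are fixed at each stage, and every edge not yet covered stays infinite
  outside the union of these private edges. To cover \<open>B\<close>, take an uncovered edge that is minimal
  modulo finite sets and modulo that union, among those almost contained in \<open>B\<close>.

  Uncountably many edges are handled by induction on their number. As \<open>k\<close> points lie in only
  finitely many common edges, the family splits along a well-order into smaller blocks such that
  each edge meets the union of all edges of earlier blocks in a finite set. Edges left uncovered by
  the earlier blocks are covered, block by block, by points outside the earlier edges, so no private
  edge is spoiled later.\<close>

section \<open>Private covers and two finiteness conditions derived from property C\<close>

definition private_cover :: "'a set set \<Rightarrow> 'a set \<Rightarrow> bool" where
  "private_cover E Y \<longleftrightarrow> (\<forall>A\<in>E. A \<inter> Y \<noteq> {}) \<and> (\<forall>y\<in>Y. \<exists>A\<in>E. A \<inter> Y = {y})"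

lemma private_cover_imp_minimal_vertex_cover:
  assumes "private_cover E Y"
  shows "minimal_vertex_cover E Y"
proof -
  have "Y \<subseteq> vertices E"
    using assms unfolding private_cover_def vertices_def by blast
  then have "vertex_cover E Y"
    using assms unfolding vertex_cover_def private_cover_def by blast
  moreover have "\<not> vertex_cover E Z" if Z: "Z \<subset> Y" for Z
  proof -
    obtain y where y: "y \<in> Y" "y \<notin> Z" using Z by blast
    then obtain A where "A \<in> E" and A: "A \<inter> Y = {y}"
      using assms unfolding private_cover_def by blast
    have "Z \<inter> A \<subseteq> A \<inter> Y" using Z by blast
    then have "Z \<inter> A = {}" using y(2) A by auto
    then show ?thesis using \<open>A \<in> E\<close> unfolding vertex_cover_def by blast
  qed
  ultimately show ?thesis unfolding minimal_vertex_cover_def by blast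
qed

text \<open>Only infinite common parts are restricted, so that deleting points from edges is
  harmless as long as the edges stay infinite. For countable families this condition alone
  suffices.\<close>

definition bounded_overlap :: "nat \<Rightarrow> 'a set set \<Rightarrow> bool" where
  "bounded_overlap r E \<longleftrightarrow>
     (\<forall>A\<in>E. infinite A) \<and> (\<forall>T\<subseteq>E. infinite (\<Inter>T) \<longrightarrow> finite T \<and> card T < r)"

text \<open>This is the dual reading of property C: for \<open>0 < r\<close>, any \<open>k\<close>
  points lie together in fewer than \<open>r\<close> edges. Finiteness of that number is what the
  closure arguments use.\<close>

definition finite_codegree :: "nat \<Rightarrow> 'a set set \<Rightarrow> bool" where
  "finite_codegree k E \<longleftrightarrow> (\<forall>F. finite F \<and> card F = k \<longrightarrow> finite {A\<in>E. F \<subseteq> A})"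

lemma property_C_imp_bounded_overlap:
  assumes "property_C r k E" "0 < r" "\<And>A. A \<in> E \<Longrightarrow> infinite A"
  shows "bounded_overlap r E"
proof -
  have "finite T \<and> card T < r" if T: "T \<subseteq> E" "infinite (\<Inter>T)" for T
  proof (rule ccontr)
    assume "\<not> (finite T \<and> card T < r)"
    then obtain S where S: "S \<subseteq> T" "finite S" "card S = r"
      by (metis infinite_arbitrarily_large linorder_not_less obtain_subset_with_card_n)
    then have "finite (vertices E \<inter> \<Inter>S)"
      using assms(1) T(1) unfolding property_C_def by blast
    \<comment> \<open>\<open>S\<close> must be nonempty: the intersection of the empty family is the
      whole type and need not lie in \<open>vertices E\<close>.\<close>
    moreover obtain A where "A \<in> S" using S assms(2) by fastforce
    then have "\<Inter>T \<subseteq> vertices E \<inter> \<Inter>S"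
      using S(1) T(1) unfolding vertices_def by blast
    ultimately show False using T(2) finite_subset by blast
  qed
  then show ?thesis using assms(3) unfolding bounded_overlap_def by blast
qed

text \<open>If \<open>r\<close> edges contained \<open>F\<close>, their common part would have at
  least \<open>k\<close> points.\<close>

lemma property_C_imp_finite_codegree:
  assumes "property_C r k E" "0 < r"
  shows "finite_codegree k E"
  unfolding finite_codegree_def
proof (intro allI impI)
  fix F :: "'a set" assume F: "finite F \<and> card F = k"
  show "finite {A\<in>E. F \<subseteq> A}"
  proof (rule ccontr)
    assume "infinite {A\<in>E. F \<subseteq> A}"
    then obtain S where S: "S \<subseteq> {A\<in>E. F \<subseteq> A}" "finite S" "card S = r"
      using infinite_arbitrarily_large[of "{A\<in>E. F \<subseteq> A}" r] by metis
    then have fin: "finite (vertices E \<inter> \<Inter>S)" "card (vertices E \<inter> \<Inter>S) < k"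
      using assms(1) unfolding property_C_def by auto
    obtain A where "A \<in> S" using S assms(2) by fastforce
    then have "F \<subseteq> vertices E \<inter> \<Inter>S"
      using S(1) unfolding vertices_def by blast
    then show False using fin F card_mono[OF fin(1)] by (metis linorder_not_less)
  qed
qed

text \<open>Distinct edges may have the same trace, so one edge is chosen for each trace in
  \<open>T\<close>. The chosen edges are as many as the traces, and their intersection contains that
  of the traces.\<close>

lemma bounded_overlap_traces:
  assumes E: "bounded_overlap r E" and G: "G \<subseteq> (\<lambda>A. A - U) ` E"
    and inf: "\<And>A. A \<in> G \<Longrightarrow> infinite A"
  shows "bounded_overlap r G"
proof -
  have "finite T \<and> card T < r" if T: "T \<subseteq> G" "infinite (\<Inter>T)" for T
  proof -
    obtain S where S: "S \<subseteq> E" "inj_on (\<lambda>A. A - U) S" "T = (\<lambda>A. A - U) ` S"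
      using subset_image_inj[of T] T(1) G by (metis (no_types, lifting) subset_trans)
    have "\<Inter>T \<subseteq> \<Inter>S" using S(3) by blast
    then have "infinite (\<Inter>S)" using T(2) finite_subset by blast
    then have "finite S \<and> card S < r" using E S(1) unfolding bounded_overlap_def by blast
    then show ?thesis using S(3) card_image[OF S(2)] by simp
  qed
  then show ?thesis using inf unfolding bounded_overlap_def by blast
qed

lemma finite_codegree_traces:
  assumes "finite_codegree k E" and G: "G \<subseteq> (\<lambda>A. A - U) ` E"
  shows "finite_codegree k G"
  unfolding finite_codegree_def
proof (intro allI impI)
  fix F :: "'a set" assume "finite F \<and> card F = k"
  then have "finite {A\<in>E. F \<subseteq> A}" using assms(1) unfolding finite_codegree_def by blast
  moreover have "{B\<in>G. F \<subseteq> B} \<subseteq> (\<lambda>A. A - U) ` {A\<in>E. F \<subseteq> A}"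
  proof
    fix B assume B: "B \<in> {B\<in>G. F \<subseteq> B}"
    then obtain A where "A \<in> E" "B = A - U" using G by auto
    then show "B \<in> (\<lambda>A. A - U) ` {A\<in>E. F \<subseteq> A}" using B by auto
  qed
  ultimately show "finite {B\<in>G. F \<subseteq> B}" by (rule finite_surj)
qed

subsection \<open>Countable hypergraphs\<close>

text \<open>\<open>W\<close> is the union of the private edges fixed so far, and \<open>H\<close> the set of edges not yet
  covered. The new private edge \<open>C\<close> is minimal in \<open>H\<close> with respect to inclusion modulo \<open>W\<close> and
  finite sets; a descending chain has an infinite intersection, so it has fewer than \<open>r\<close> members.\<close>

lemma almost_minimal_edge:
  assumes H: "bounded_overlap r H" and W: "\<And>A. A \<in> H \<Longrightarrow> infinite (A - W)" and B: "B \<in> H"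
  obtains C y where "C \<in> H" "y \<in> B" "y \<in> C" "y \<notin> W"
    "\<And>A. A \<in> H \<Longrightarrow> y \<notin> A \<Longrightarrow> infinite (A - (W \<union> C))"
proof -
  \<comment> \<open>No linear order is demanded: a member lying below all others modulo
    \<open>W\<close> and finite sets is enough for \<open>T\<close> to be extended
    downwards.\<close>
  define chain where "chain T \<longleftrightarrow> T \<subseteq> H \<and> B \<in> T \<and> finite T \<and>
      (\<exists>C\<in>T. \<forall>D\<in>T. finite (C - W - D))" for T
  have inter: "infinite (\<Inter>T - W)" if T: "chain T" for T
  proof
    assume "finite (\<Inter>T - W)"
    obtain C where C: "C \<in> T" "\<forall>D\<in>T. finite (C - W - D)" using T unfolding chain_def by blast
    \<comment> \<open>As \<open>T\<close> is finite, \<open>C - W\<close> exceeds the common part of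
      \<open>T\<close> by finitely many points only.\<close>
    have "C - W \<subseteq> (\<Inter>T - W) \<union> (\<Union>D\<in>T. C - W - D)" by blast
    moreover have "finite (\<Union>D\<in>T. C - W - D)"
      using C(2) T unfolding chain_def by (intro finite_UN_I) blast+
    then have "finite ((\<Inter>T - W) \<union> (\<Union>D\<in>T. C - W - D))"
      using \<open>finite (\<Inter>T - W)\<close> by (rule finite_UnI[rotated])
    ultimately have "finite (C - W)" using finite_subset by blast
    then show False using W C(1) T unfolding chain_def by blast
  qed
  have bound: "card T < r" if T: "chain T" for T
  proof -
    have "infinite (\<Inter>T)" using inter[OF T] by auto
    then show ?thesis using H T unfolding bounded_overlap_def chain_def by blast
  qed
  have "finite (B - W - B)" by (rule finite_subset[of _ "{}"]) auto
  then have "chain {B}" using B unfolding chain_def by blast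
  then obtain T where T: "chain T" and max: "\<And>S. chain S \<Longrightarrow> card S \<le> card T"
    using ex_has_greatest_nat[of chain "{B}" card r] bound by (metis less_imp_le)
  obtain C where C: "C \<in> T" "\<forall>D\<in>T. finite (C - W - D)" using T unfolding chain_def by blast
  \<comment> \<open>Taking \<open>y\<close> in every member of \<open>T\<close> ensures that an edge
    avoiding \<open>y\<close> is new to \<open>T\<close>.\<close>
  obtain y where y: "y \<in> \<Inter>T - W" using inter[OF T] by (metis ex_in_conv finite.emptyI)
  show thesis
  proof
    show "C \<in> H" "y \<in> B" "y \<in> C" "y \<notin> W" using T C y unfolding chain_def by auto
    fix A assume A: "A \<in> H" "y \<notin> A"
    then have "A \<notin> T" using y by blast
    show "infinite (A - (W \<union> C))"
    proof
      assume fin: "finite (A - (W \<union> C))"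
      have "finite (A - W - D)" if "D \<in> T" for D
      proof -
        have "A - W - D \<subseteq> (A - (W \<union> C)) \<union> (C - W - D)" by blast
        then show ?thesis using fin C(2) that finite_subset by blast
      qed
      moreover have "finite (A - W - A)" by (rule finite_subset[of _ "{}"]) auto
      \<comment> \<open>\<open>A\<close> is almost below \<open>C\<close>, hence almost below all of
        \<open>T\<close>; inserting it contradicts the maximal size of \<open>T\<close>.\<close>
      ultimately have "\<forall>D\<in>insert A T. finite (A - W - D)" by blast
      then have "chain (insert A T)" using T A(1) unfolding chain_def by blast
      then have "card (insert A T) \<le> card T" using max by blast
      then show False using \<open>A \<notin> T\<close> T unfolding chain_def by simp
    qed
  qed
qed

lemma bounded_overlap_subset:
  "bounded_overlap r E \<Longrightarrow> H \<subseteq> E \<Longrightarrow> bounded_overlap r H"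
  unfolding bounded_overlap_def by blast

lemma countable_private_cover:
  assumes E: "bounded_overlap r E" and "countable E"
  shows "\<exists>Y. private_cover E Y"
proof -
  \<comment> \<open>For empty \<open>E\<close> the values of \<open>e\<close> are arbitrary, hence
    the guard \<open>e n \<in> E\<close> in \<open>J\<close>.\<close>
  define e where "e = from_nat_into E"
  have e: "\<exists>n. e n = A" if "A \<in> E" for A
    unfolding e_def using from_nat_into_surj[OF \<open>countable E\<close> that] .
  \<comment> \<open>\<open>Y\<close> collects the points chosen and \<open>Q\<close> their private
    edges. The last clause leaves room to cover every remaining edge outside
    \<open>\<Union>Q\<close>.\<close>
  define I :: "'a set \<times> 'a set set \<Rightarrow> bool" where
    "I = (\<lambda>(Y, Q). (\<forall>y\<in>Y. \<exists>A\<in>Q. A \<inter> Y = {y}) \<and> Q \<subseteq> E \<and>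
          (\<forall>A\<in>E. A \<inter> Y = {} \<longrightarrow> infinite (A - \<Union>Q)))"
  \<comment> \<open>New points avoid all private edges already fixed, so the traces of these edges
    on the growing cover never change.\<close>
  define J :: "nat \<Rightarrow> 'a set \<times> 'a set set \<Rightarrow> 'a set \<times> 'a set set \<Rightarrow> bool" where
    "J = (\<lambda>n (Y, Q) (Y', Q'). Y \<subseteq> Y' \<and> Q \<subseteq> Q' \<and> (Y' - Y) \<inter> \<Union>Q = {} \<and>
          (e n \<in> E \<longrightarrow> e n \<inter> Y' \<noteq> {}))"
  have step: "\<exists>t. I t \<and> J n s t" if "I s" for n s
  proof (cases "e n \<in> E \<and> e n \<inter> fst s = {}")
    case False
    then have "J n s s" unfolding J_def by (auto split: prod.splits)
    then show ?thesis using that by blast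
  next
    case True
    obtain Y Q where s: "s = (Y, Q)" by fastforce
    define H where "H = {A\<in>E. A \<inter> Y = {}}"
    have "bounded_overlap r H"
      using E bounded_overlap_subset[of r E H] unfolding H_def by blast
    moreover have "infinite (A - \<Union>Q)" if "A \<in> H" for A
      using \<open>I s\<close> that unfolding s I_def H_def by blast
    moreover have "e n \<in> H" using True unfolding s H_def by simp
    ultimately obtain C y where C: "C \<in> H" "y \<in> e n" "y \<in> C" "y \<notin> \<Union>Q"
      "\<And>A. A \<in> H \<Longrightarrow> y \<notin> A \<Longrightarrow> infinite (A - (\<Union>Q \<union> C))"
      using almost_minimal_edge[of r H "\<Union>Q" "e n"] by metis
    have priv: "\<exists>A\<in>insert C Q. A \<inter> insert y Y = {z}" if "z \<in> insert y Y" for z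
    proof (cases "z = y")
      case True
      then have "C \<inter> insert y Y = {z}" using C unfolding H_def by blast
      then show ?thesis by blast
    next
      case False
      then have "z \<in> Y" using that by blast
      then obtain A where "A \<in> Q" "A \<inter> Y = {z}" using \<open>I s\<close> unfolding s I_def by blast
      moreover then have "A \<inter> insert y Y = {z}" using C(4) by blast
      ultimately show ?thesis by blast
    qed
    have "infinite (A - \<Union>(insert C Q))" if "A \<in> E" "A \<inter> insert y Y = {}" for A
    proof -
      have "A \<in> H" "y \<notin> A" using that unfolding H_def by auto
      then show ?thesis using C(5)[of A] by (simp add: Un_commute)
    qed
    moreover have "insert C Q \<subseteq> E" using \<open>I s\<close> C(1) unfolding s I_def H_def by blast
    ultimately have "I (insert y Y, insert C Q)"
      using priv unfolding I_def by auto
    moreover have "J n s (insert y Y, insert C Q)"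
      using C(2,4) unfolding J_def s by auto
    ultimately show ?thesis by blast
  qed
  have "I ({}, {})" using E unfolding I_def bounded_overlap_def by simp
  then obtain f where f: "\<And>n. I (f n)" "\<And>n. J n (f n) (f (Suc n))"
    using dependent_nat_choice[of "\<lambda>_. I" J] step by metis
  define Y where "Y n = fst (f n)" for n
  define Q where "Q n = snd (f n)" for n
  have fYQ: "f n = (Y n, Q n)" for n unfolding Y_def Q_def by simp
  have I: "\<forall>y\<in>Y n. \<exists>A\<in>Q n. A \<inter> Y n = {y}" "Q n \<subseteq> E" for n
    using f(1)[of n] unfolding fYQ I_def by auto
  have J: "Y n \<subseteq> Y (Suc n)" "Q n \<subseteq> Q (Suc n)" "(Y (Suc n) - Y n) \<inter> \<Union>(Q n) = {}"
    "e n \<in> E \<Longrightarrow> e n \<inter> Y (Suc n) \<noteq> {}" for n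
    using f(2)[of n] unfolding fYQ J_def by auto
  have Ymono: "Y m \<subseteq> Y n" if "m \<le> n" for m n using lift_Suc_mono_le[of Y] J(1) that by blast
  have Qmono: "Q m \<subseteq> Q n" if "m \<le> n" for m n using lift_Suc_mono_le[of Q] J(2) that by blast
  have stable: "A \<inter> Y (m + d) = A \<inter> Y m" if "A \<in> Q m" for A m d
  proof (induction d)
    case (Suc d)
    have "A \<in> Q (m + d)" using that Qmono[of m "m + d"] by auto
    then have "A \<inter> Y (Suc (m + d)) = A \<inter> Y (m + d)" using J(1,3)[of "m + d"] by blast
    then show ?case using Suc by simp
  qed simp
  have "private_cover E (\<Union>n. Y n)"
    unfolding private_cover_def
  proof (intro conjI ballI)
    fix A assume A: "A \<in> E"
    then obtain n where "e n = A" using e by blast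
    then have "A \<inter> Y (Suc n) \<noteq> {}" using J(4)[of n] A by simp
    then show "A \<inter> (\<Union>n. Y n) \<noteq> {}" by blast
  next
    fix y assume "y \<in> (\<Union>n. Y n)"
    then obtain m where "y \<in> Y m" by blast
    then obtain A where A: "A \<in> Q m" "A \<inter> Y m = {y}" using I(1) by blast
    have "A \<inter> Y n \<subseteq> {y}" for n
    proof -
      have "Y n \<subseteq> Y (m + n)" using Ymono by simp
      then show ?thesis using stable[OF A(1), of n] A(2) by blast
    qed
    then have "A \<inter> (\<Union>n. Y n) = {y}" using A(2) by blast
    then show "\<exists>A\<in>E. A \<inter> (\<Union>n. Y n) = {y}" using A(1) I(2) by blast
  qed
  then show ?thesis by blast
qed

subsection \<open>Gluing along a well-founded decomposition\<close>

text \<open>Recursion along \<open>R\<close> covers the still uncovered edges of block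
  \<open>i\<close> by points outside \<open>U i\<close>. A private edge of block \<open>i\<close>
  misses earlier choices because it was uncovered, and later ones because they avoid all edges of
  block \<open>i\<close>. Arbitrary subfamilies occur in \<open>block\<close> since the uncovered
  edges depend on earlier choices.\<close>

lemma glue_private_covers:
  fixes \<rho> :: "'a set \<Rightarrow> 'i"
  assumes wf: "wf R" and tot: "\<And>i j. i \<in> \<rho> ` E \<Longrightarrow> j \<in> \<rho> ` E \<Longrightarrow> i \<noteq> j \<Longrightarrow> (i, j) \<in> R \<or> (j, i) \<in> R"
    and U: "\<And>i. U i = \<Union>{B\<in>E. (\<rho> B, i) \<in> R}"
    and block: "\<And>i G. G \<subseteq> (\<lambda>A. A - U i) ` {A\<in>E. \<rho> A = i} \<Longrightarrow> \<exists>Y. private_cover G Y"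
  shows "\<exists>Y. private_cover E Y"
proof -
  define G where "G i Z = (\<lambda>A. A - U i) ` {A\<in>E. \<rho> A = i \<and> A \<inter> Z = {}}" for i Z
  have "\<exists>f. \<forall>i. private_cover (G i (\<Union>j\<in>{j. (j, i) \<in> R}. f j)) (f i)"
  proof (rule dependent_wf_choice[OF wf,
        where P = "\<lambda>f i Y. private_cover (G i (\<Union>j\<in>{j. (j, i) \<in> R}. f j)) Y"])
    fix f g :: "'i \<Rightarrow> 'a set" and i Y
    assume "\<And>j. (j, i) \<in> R \<Longrightarrow> f j = g j"
    then have "(\<Union>j\<in>{j. (j, i) \<in> R}. f j) = (\<Union>j\<in>{j. (j, i) \<in> R}. g j)" by simp
    then show "private_cover (G i (\<Union>j\<in>{j. (j, i) \<in> R}. f j)) Y =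
        private_cover (G i (\<Union>j\<in>{j. (j, i) \<in> R}. g j)) Y" by simp
  next
    fix i and f :: "'i \<Rightarrow> 'a set"
    show "\<exists>Y. private_cover (G i (\<Union>j\<in>{j. (j, i) \<in> R}. f j)) Y"
      by (rule block[of _ i]) (auto simp: G_def)
  qed
  then obtain f where f: "\<And>i. private_cover (G i (\<Union>j\<in>{j. (j, i) \<in> R}. f j)) (f i)" by blast
  let ?Z = "\<lambda>i. \<Union>j\<in>{j. (j, i) \<in> R}. f j"
  \<comment> \<open>Each private trace is lifted to an edge of \<open>E\<close> that all earlier
    choices miss.\<close>
  have witness: "\<exists>A\<in>E. \<rho> A = i \<and> A \<inter> ?Z i = {} \<and> (A - U i) \<inter> f i = {y}" if "y \<in> f i" for i y
    using f[of i] that unfolding private_cover_def G_def by auto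
  have disj: "f i \<inter> U i = {}" for i
  proof -
    have "y \<notin> U i" if "y \<in> f i" for y using witness[OF that] by blast
    then show ?thesis by blast
  qed
  have "private_cover E (\<Union>i. f i)"
    unfolding private_cover_def
  proof (intro conjI ballI)
    fix A assume A: "A \<in> E"
    show "A \<inter> (\<Union>i. f i) \<noteq> {}"
    proof (cases "A \<inter> ?Z (\<rho> A) = {}")
      case True
      then have "A - U (\<rho> A) \<in> G (\<rho> A) (?Z (\<rho> A))" using A unfolding G_def by blast
      then have "(A - U (\<rho> A)) \<inter> f (\<rho> A) \<noteq> {}" using f unfolding private_cover_def by blast
      then show ?thesis by blast
    qed blast
  next
    fix y assume "y \<in> (\<Union>i. f i)"
    then obtain i where y: "y \<in> f i" by blast
    then obtain A where A: "A \<in> E" "\<rho> A = i" "A \<inter> ?Z i = {}" "(A - U i) \<inter> f i = {y}"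
      using witness by blast
    have "z = y" if z: "z \<in> A" "z \<in> f j" for z j
    proof -
      obtain B where B: "B \<in> E" "\<rho> B = j" using witness[OF z(2)] by blast
      \<comment> \<open>Totality is known only for indices of edges; \<open>B\<close> shows that
        \<open>j\<close> is one.\<close>
      consider "j = i" | "(j, i) \<in> R" | "(i, j) \<in> R" using tot[of i j] A B by blast
      then show ?thesis
      proof cases
        case 1
        then show ?thesis using A(4) z disj[of i] by blast
      next
        case 2
        then show ?thesis using A(3) z by blast
      next
        case 3
        then have "z \<in> U j" using A z(1) unfolding U by blast
        then show ?thesis using disj[of j] z(2) by blast
      qed
    qed
    moreover have "y \<in> A" using A(4) by blast
    ultimately have "A \<inter> (\<Union>i. f i) = {y}" using y by blast
    then show "\<exists>A\<in>E. A \<inter> (\<Union>i. f i) = {y}" using A(1) by blast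
  qed
  then show ?thesis by blast
qed

subsection \<open>Closed subfamilies\<close>

text \<open>Closure under adding every edge through \<open>k\<close> vertices already present makes
  outside edges almost disjoint from \<open>\<Union>C\<close>.\<close>

definition closed_subfamily :: "nat \<Rightarrow> 'a set set \<Rightarrow> 'a set set \<Rightarrow> bool" where
  "closed_subfamily k E C \<longleftrightarrow> C \<subseteq> E \<and>
     (\<forall>F. finite F \<and> card F = k \<and> F \<subseteq> \<Union>C \<longrightarrow> {A\<in>E. F \<subseteq> A} \<subseteq> C)"

lemma closed_subfamily_finite_Int:
  assumes "closed_subfamily k E C" "A \<in> E" "A \<notin> C"
  shows "finite (A \<inter> \<Union>C)"
proof (rule ccontr)
  assume "infinite (A \<inter> \<Union>C)"
  then obtain F where "F \<subseteq> A \<inter> \<Union>C" "finite F" "card F = k"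
    using infinite_arbitrarily_large by metis
  then show False using assms unfolding closed_subfamily_def by blast
qed

lemma closed_subfamily_Inter:
  assumes "\<And>C. C \<in> \<C> \<Longrightarrow> closed_subfamily k E C" "\<C> \<noteq> {}"
  shows "closed_subfamily k E (\<Inter>\<C>)"
  unfolding closed_subfamily_def
proof (intro conjI allI impI)
  show "\<Inter>\<C> \<subseteq> E" using assms unfolding closed_subfamily_def by blast
  fix F assume F: "finite F \<and> card F = k \<and> F \<subseteq> \<Union>(\<Inter>\<C>)"
  have "{A\<in>E. F \<subseteq> A} \<subseteq> C" if "C \<in> \<C>" for C
  proof -
    have "F \<subseteq> \<Union>C" using F that by blast
    then show ?thesis using F assms(1)[OF that] unfolding closed_subfamily_def by blast
  qed
  then show "{A\<in>E. F \<subseteq> A} \<subseteq> \<Inter>\<C>" by blast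
qed

text \<open>A finite \<open>F\<close> inside the union of a chain lies inside one member.
  Nonemptiness matters for \<open>k = 0\<close>, where the empty subfamily of a nonempty
  \<open>E\<close> is not closed.\<close>

lemma closed_subfamily_chain_Union:
  assumes cl: "\<And>C. C \<in> \<C> \<Longrightarrow> closed_subfamily k E C" and "\<C> \<noteq> {}"
    and chain: "\<And>C D. C \<in> \<C> \<Longrightarrow> D \<in> \<C> \<Longrightarrow> C \<subseteq> D \<or> D \<subseteq> C"
  shows "closed_subfamily k E (\<Union>\<C>)"
  unfolding closed_subfamily_def
proof (intro conjI allI impI)
  show "\<Union>\<C> \<subseteq> E" using cl unfolding closed_subfamily_def by blast
  fix F assume F: "finite F \<and> card F = k \<and> F \<subseteq> \<Union>(\<Union>\<C>)"
  have "\<Union>C \<subseteq> \<Union>D \<or> \<Union>D \<subseteq> \<Union>C" if "C \<in> \<C>" "D \<in> \<C>" for C D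
    using chain[OF that] Union_mono[of C D] Union_mono[of D C] by argo
  then have "subset.chain UNIV (Union ` \<C>)" unfolding subset_chain_def by blast
  moreover have "F \<subseteq> \<Union>(Union ` \<C>)" using F by blast
  moreover have "finite F" "Union ` \<C> \<noteq> {}" using F \<open>\<C> \<noteq> {}\<close> by simp_all
  ultimately obtain V where "V \<in> Union ` \<C>" "F \<subseteq> V"
    using finite_subset_Union_chain by metis
  then obtain C where "C \<in> \<C>" "F \<subseteq> \<Union>C" by blast
  then show "{A\<in>E. F \<subseteq> A} \<subseteq> \<Union>\<C>" using F cl unfolding closed_subfamily_def by blast
qed

section \<open>Cardinality of generated closed subfamilies\<close>

lemma card_of_finite_ordLeq_infinite:
  assumes "Card_order c" "infinite (Field c)" "finite A"
  shows "|A| \<le>o c"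
proof -
  have "|A| <o natLeq" using assms(3) finite_iff_ordLess_natLeq by blast
  also have "natLeq \<le>o |Field c|" using assms(2) infinite_iff_natLeq_ordLeq by blast
  also have "|Field c| =o c" using assms(1) by (rule card_of_Field_ordIso)
  finally show ?thesis by (rule ordLess_imp_ordLeq)
qed

lemma card_of_subsets_of_card_ordLeq:
  assumes c: "Card_order c" "infinite (Field c)" and V: "|V| \<le>o c"
  shows "|{F. F \<subseteq> V \<and> finite F \<and> card F = k}| \<le>o c"
proof (induction k)
  case 0
  have "{F. F \<subseteq> V \<and> finite F \<and> card F = 0} \<subseteq> {{}}" by auto
  then have "finite {F. F \<subseteq> V \<and> finite F \<and> card F = 0}" using finite_subset by blast
  then show ?case using card_of_finite_ordLeq_infinite[OF c] by blast
next
  case (Suc k)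
  let ?S = "{F. F \<subseteq> V \<and> finite F \<and> card F = k}"
  have "{F. F \<subseteq> V \<and> finite F \<and> card F = Suc k} \<subseteq> (\<Union>x\<in>V. insert x ` ?S)"
  proof
    fix F assume "F \<in> {F. F \<subseteq> V \<and> finite F \<and> card F = Suc k}"
    then have F: "F \<subseteq> V" "finite F" "card F = Suc k" by auto
    then obtain x D where "F = insert x D" "x \<notin> D" "card D = k" by (auto simp: card_Suc_eq)
    then show "F \<in> (\<Union>x\<in>V. insert x ` ?S)" using F by auto
  qed
  moreover have "|\<Union>x\<in>V. insert x ` ?S| \<le>o c"
  proof (rule card_of_UNION_ordLeq_infinite_Field[OF c(2,1) V], intro ballI)
    fix x show "|insert x ` ?S| \<le>o c" by (rule ordLeq_transitive[OF card_of_image Suc])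
  qed
  ultimately show ?case by (rule ordLeq_transitive[OF card_of_mono1])
qed

text \<open>All edges through \<open>k\<close> present vertices are added, and this is iterated
  \<open>\<omega>\<close> times. Countable edges keep the vertices, and so their
  \<open>k\<close>-subsets, at most \<open>c\<close> in number; each such subset adds finitely many
  edges.\<close>

lemma closed_subfamily_exists:
  assumes E: "finite_codegree k E" "\<And>A. A \<in> E \<Longrightarrow> countable A"
    and c: "Card_order c" "infinite (Field c)" and D: "D \<subseteq> E" "|D| \<le>o c"
  obtains C where "closed_subfamily k E C" "D \<subseteq> C" "|C| \<le>o c"
proof -
  define step where "step X = X \<union> (\<Union>F\<in>{F. F \<subseteq> \<Union>X \<and> finite F \<and> card F = k}. {A\<in>E. F \<subseteq> A})" for X
  define X where "X n = (step ^^ n) D" for n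
  have X0: "X 0 = D" and XS: "X (Suc n) = step (X n)" for n unfolding X_def by simp_all
  have natc: "|UNIV :: nat set| \<le>o c"
    using c(2) card_of_Field_ordIso[OF c(1)] infinite_iff_card_of_nat[of "Field c"]
      ordLeq_ordIso_trans[of "|UNIV :: nat set|" "|Field c|" c] by blast
  have bound: "X n \<subseteq> E \<and> |X n| \<le>o c" for n
  proof (induction n)
    case 0
    then show ?case using D X0 by simp
  next
    case (Suc n)
    have "|\<Union>A\<in>X n. A| \<le>o c"
    proof (rule card_of_UNION_ordLeq_infinite_Field[OF c(2,1)], use Suc in blast, intro ballI)
      fix A assume "A \<in> X n"
      then have "countable A" using Suc E(2) by blast
      then have "|A| \<le>o |UNIV :: nat set|" unfolding countable_card_of_nat .
      then show "|A| \<le>o c" using natc by (rule ordLeq_transitive)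
    qed
    then have "|\<Union>(X n)| \<le>o c" by simp
    note subsets = card_of_subsets_of_card_ordLeq[OF c this, of k]
    have "|\<Union>F\<in>{F. F \<subseteq> \<Union>(X n) \<and> finite F \<and> card F = k}. {A\<in>E. F \<subseteq> A}| \<le>o c"
    proof (rule card_of_UNION_ordLeq_infinite_Field[OF c(2,1) subsets], intro ballI)
      fix F assume "F \<in> {F. F \<subseteq> \<Union>(X n) \<and> finite F \<and> card F = k}"
      then have "finite {A\<in>E. F \<subseteq> A}" using E(1) unfolding finite_codegree_def by blast
      then show "|{A\<in>E. F \<subseteq> A}| \<le>o c" using card_of_finite_ordLeq_infinite[OF c] by blast
    qed
    then have "|step (X n)| \<le>o c"
      unfolding step_def by (rule card_of_Un_ordLeq_infinite_Field[OF c(2) conjunct2[OF Suc] _ c(1)])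
    moreover have "step (X n) \<subseteq> E" using Suc unfolding step_def by blast
    ultimately show ?case unfolding XS by blast
  qed
  have "X n \<subseteq> X (Suc n)" for n unfolding XS step_def by blast
  then have mono: "X m \<subseteq> X n" if "m \<le> n" for m n using lift_Suc_mono_le[of X] that by blast
  show thesis
  proof
    show "D \<subseteq> (\<Union>n. X n)" using X0 by blast
    show "|\<Union>n. X n| \<le>o c"
      by (rule card_of_UNION_ordLeq_infinite_Field[OF c(2,1) natc]) (use bound in blast)
    show "closed_subfamily k E (\<Union>n. X n)"
      unfolding closed_subfamily_def
    proof (intro conjI allI impI)
      show "(\<Union>n. X n) \<subseteq> E" using bound by blast
      fix F assume F: "finite F \<and> card F = k \<and> F \<subseteq> \<Union>(\<Union>n. X n)"
      \<comment> \<open>The stages increase, so the finite set \<open>F\<close> appears at one of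
        them and its edges enter at the next.\<close>
      have "\<Union>(X m) \<subseteq> \<Union>(X n) \<or> \<Union>(X n) \<subseteq> \<Union>(X m)" for m n
        using mono Union_mono nle_le by metis
      then have "subset.chain UNIV (range (\<lambda>n. \<Union>(X n)))" unfolding subset_chain_def by blast
      moreover have "F \<subseteq> \<Union>(range (\<lambda>n. \<Union>(X n)))" using F by blast
      moreover have "finite F" "range (\<lambda>n. \<Union>(X n)) \<noteq> {}" using F by simp_all
      ultimately obtain V where "V \<in> range (\<lambda>n. \<Union>(X n))" "F \<subseteq> V"
        using finite_subset_Union_chain by metis
      then obtain n where "F \<subseteq> \<Union>(X n)" by blast
      then have "{A\<in>E. F \<subseteq> A} \<subseteq> X (Suc n)" using F unfolding XS step_def by blast
      then show "{A\<in>E. F \<subseteq> A} \<subseteq> (\<Union>n. X n)" by blast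
    qed
  qed
qed

text \<open>Defining the hull as an intersection makes it monotone in \<open>D\<close>; its size is
  bounded through any closed subfamily containing \<open>D\<close>.\<close>

definition hull_in :: "nat \<Rightarrow> 'a set set \<Rightarrow> 'a set set \<Rightarrow> 'a set set" where
  "hull_in k E D = \<Inter>{C. closed_subfamily k E C \<and> D \<subseteq> C}"

lemma hull_in:
  assumes "D \<subseteq> E"
  shows closed_subfamily_hull_in: "closed_subfamily k E (hull_in k E D)"
    and subset_hull_in: "D \<subseteq> hull_in k E D"
proof -
  have "closed_subfamily k E E" unfolding closed_subfamily_def by blast
  then show "closed_subfamily k E (hull_in k E D)"
    unfolding hull_in_def using assms by (intro closed_subfamily_Inter) auto
  show "D \<subseteq> hull_in k E D" unfolding hull_in_def by blast
qed

lemma hull_in_mono: "D \<subseteq> D' \<Longrightarrow> hull_in k E D \<subseteq> hull_in k E D'"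
  unfolding hull_in_def by blast

subsection \<open>Hypergraphs of arbitrary cardinality\<close>

text \<open>Induction on \<open>|E|\<close>. The hulls \<open>H a\<close> of initial segments of a
  minimal well-order of \<open>E\<close> increase, exhaust \<open>E\<close> and are smaller than
  \<open>E\<close>. Sorting edges by the first hull containing them gives the blocks to be
  glued.\<close>

lemma private_cover_exists:
  assumes "bounded_overlap r E" "finite_codegree k E" "\<And>A. A \<in> E \<Longrightarrow> countable A"
  shows "\<exists>Y. private_cover E Y"
  using assms
proof (induction E rule: wf_induct_rule[OF wf_inv_image[OF wf_ordLess, of card_of]])
  case (1 E)
  note E = 1(2-4)
  show ?case
  proof (cases "countable E")
    case True
    then show ?thesis using countable_private_cover[OF E(1)] by blast
  next
    case False
    \<comment> \<open>As a relation, \<open>|E|\<close> is a well-order of \<open>E\<close> itself,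
      so edges serve as indices.\<close>
    define \<kappa> where "\<kappa> = |E|"
    have Card: "Card_order \<kappa>" and Field: "Field \<kappa> = E"
      unfolding \<kappa>_def by (rule card_of_Card_order, rule Field_card_of)
    have nat_less: "natLeq <o \<kappa>"
      using False not_ordLeq_iff_ordLess[OF natLeq_Well_order card_of_Well_order[of E]]
      unfolding \<kappa>_def countable_card_le_natLeq by blast
    have wo: "well_order_on E \<kappa>" unfolding \<kappa>_def by (rule card_of_well_order_on)
    then have lin: "refl_on E \<kappa>" "trans \<kappa>" "antisym \<kappa>" "total_on E \<kappa>" and wf: "wf (\<kappa> - Id)"
      unfolding order_on_defs by auto
    define H where "H a = hull_in k E (under \<kappa> a)" for a
    have under: "under \<kappa> a \<subseteq> E" for a using under_Field[of \<kappa> a] Field by simp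
    have H: "closed_subfamily k E (H a)" "under \<kappa> a \<subseteq> H a" for a
      unfolding H_def using hull_in[OF under] by auto
    have H_mono: "H a \<subseteq> H b" if "(a, b) \<in> \<kappa>" for a b
      unfolding H_def by (rule hull_in_mono) (use that lin(2) in \<open>auto simp: under_def dest: transD\<close>)
    have H_card: "|H a| <o |E|" if a: "a \<in> E" for a
    proof -
      have "infinite E" using False countable_finite by blast
      then obtain N where N: "countable N" "infinite N" "N \<subseteq> E"
        using infinite_countable_subset' by metis
      then have N_less: "|N| <o \<kappa>"
        using nat_less ordLeq_ordLess_trans countable_card_le_natLeq by metis
      \<comment> \<open>The size bound for closed subfamilies requires an infinite cardinal. A
        finite segment is replaced by a countably infinite \<open>N\<close>, which is still below
        \<open>\<kappa>\<close> because \<open>E\<close> is uncountable.\<close>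
      define c where "c = |if finite (underS \<kappa> a) then N else underS \<kappa> a|"
      have "Card_order c" unfolding c_def by (rule card_of_Card_order)
      moreover have "infinite (Field c)" "c <o \<kappa>"
        using N(2) N_less card_of_underS[OF Card, of a] a Field
        unfolding c_def by (simp_all add: Field_card_of)
      ultimately have c: "Card_order c" "infinite (Field c)" "c <o \<kappa>" by blast+
      have "|underS \<kappa> a| \<le>o c"
        using card_of_finite_ordLeq_infinite[OF c(1,2), of "underS \<kappa> a"]
        by (cases "finite (underS \<kappa> a)") (auto simp: c_def card_of_refl ordIso_imp_ordLeq)
      then have "|underS \<kappa> a \<union> {a}| \<le>o c"
        using card_of_Un_ordLeq_infinite_Field[OF c(2) _ _ c(1)]
          card_of_finite_ordLeq_infinite[OF c(1,2), of "{a}"] by blast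
      moreover have "under \<kappa> a \<subseteq> underS \<kappa> a \<union> {a}" unfolding under_def underS_def by blast
      ultimately have "|under \<kappa> a| \<le>o c" by (rule ordLeq_transitive[OF card_of_mono1, rotated])
      then obtain C where C: "closed_subfamily k E C" "under \<kappa> a \<subseteq> C" "|C| \<le>o c"
        using closed_subfamily_exists[OF E(2,3) c(1,2) under, of a] by blast
      then have "H a \<subseteq> C" unfolding H_def hull_in_def by blast
      then have "|H a| \<le>o c" using C(3) by (rule ordLeq_transitive[OF card_of_mono1])
      then show ?thesis using c(3) unfolding \<kappa>_def by (rule ordLeq_ordLess_trans)
    qed
    have "\<exists>a. a \<in> E \<and> A \<in> H a \<and> (\<forall>b. (b, a) \<in> \<kappa> - Id \<longrightarrow> A \<notin> H b)" if A: "A \<in> E" for A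
    proof -
      \<comment> \<open>Some index exists: \<open>A\<close> belongs to its own segment
        \<open>under \<kappa> A\<close>.\<close>
      have "A \<in> {a\<in>E. A \<in> H a}"
        using A H(2)[of A] lin(1) unfolding under_def refl_on_def by blast
      then obtain a where "a \<in> {a\<in>E. A \<in> H a}"
        and min: "\<And>b. (b, a) \<in> \<kappa> - Id \<Longrightarrow> b \<notin> {a\<in>E. A \<in> H a}"
        by (rule wfE_min[OF wf]) presburger
      moreover have "b \<in> E" if "(b, a) \<in> \<kappa>" for b using FieldI1[OF that] Field by simp
      ultimately show ?thesis by blast
    qed
    then obtain \<rho> where \<rho>: "\<And>A. A \<in> E \<Longrightarrow> \<rho> A \<in> E" "\<And>A. A \<in> E \<Longrightarrow> A \<in> H (\<rho> A)"
      "\<And>A b. A \<in> E \<Longrightarrow> (b, \<rho> A) \<in> \<kappa> - Id \<Longrightarrow> A \<notin> H b" by metis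
    define U where "U i = \<Union>{B\<in>E. (\<rho> B, i) \<in> \<kappa> - Id}" for i
    have fin: "finite (A \<inter> U (\<rho> A))" if A: "A \<in> E" for A
    proof (cases "{b. (b, \<rho> A) \<in> \<kappa> - Id} = {}")
      case True
      then have "U (\<rho> A) = {}" unfolding U_def by blast
      then show ?thesis by simp
    next
      case False
      let ?\<C> = "H ` {b. (b, \<rho> A) \<in> \<kappa> - Id}"
      \<comment> \<open>The union of all earlier hulls contains every earlier block but not
        \<open>A\<close>; being closed, it meets \<open>A\<close> in a finite set only.\<close>
      have "closed_subfamily k E (\<Union>?\<C>)"
      proof (rule closed_subfamily_chain_Union)
        fix C D assume "C \<in> ?\<C>" "D \<in> ?\<C>"
        then obtain b d where "C = H b" "D = H d" "(b, \<rho> A) \<in> \<kappa>" "(d, \<rho> A) \<in> \<kappa>" by blast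
        moreover then have "b \<in> E" "d \<in> E" using Field FieldI1[of _ _ \<kappa>] by simp_all
        ultimately show "C \<subseteq> D \<or> D \<subseteq> C"
          using H_mono lin(4) unfolding total_on_def by (metis subset_refl)
      qed (use H False in auto)
      moreover have "A \<notin> \<Union>?\<C>" using \<rho>(3)[OF A] by blast
      ultimately have "finite (A \<inter> \<Union>(\<Union>?\<C>))" using closed_subfamily_finite_Int A by blast
      moreover have "U (\<rho> A) \<subseteq> \<Union>(\<Union>?\<C>)" unfolding U_def using \<rho>(2) by blast
      ultimately show ?thesis by (meson Int_mono finite_subset subset_refl)
    qed
    show ?thesis
    proof (rule glue_private_covers[OF wf, where \<rho> = \<rho> and U = U])
      fix i j assume "i \<in> \<rho> ` E" "j \<in> \<rho> ` E" "i \<noteq> j"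
      then show "(i, j) \<in> \<kappa> - Id \<or> (j, i) \<in> \<kappa> - Id"
        using \<rho>(1) lin(4) unfolding total_on_def by blast
    next
      fix i G assume G: "G \<subseteq> (\<lambda>A. A - U i) ` {A\<in>E. \<rho> A = i}"
      then have GE: "G \<subseteq> (\<lambda>A. A - U i) ` E" by blast
      show "\<exists>Y. private_cover G Y"
      \<comment> \<open>A nonempty \<open>G\<close> forces \<open>i \<in> E\<close>, which the bound
        on \<open>H i\<close> requires.\<close>
      proof (cases "G = {}")
        case True
        then show ?thesis unfolding private_cover_def by blast
      next
        case False
        then have "i \<in> E" using G \<rho>(1) by blast
        \<comment> \<open>Removing \<open>U i\<close> costs an edge of block \<open>i\<close> only
          finitely many points.\<close>
        have "infinite B" if B: "B \<in> G" for B
        proof -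
          obtain A where A: "A \<in> E" "\<rho> A = i" "B = A - U i" using B G by blast
          moreover have "infinite A" using A(1) E(1) unfolding bounded_overlap_def by blast
          moreover have "A \<subseteq> B \<union> (A \<inter> U i)" using A(3) by blast
          ultimately show ?thesis using fin[OF A(1)] finite_subset by blast
        qed
        then have "bounded_overlap r G" using bounded_overlap_traces[OF E(1) GE] by blast
        moreover have "finite_codegree k G" using finite_codegree_traces[OF E(2) GE] .
        moreover have "countable B" if "B \<in> G" for B using that GE E(3) by auto
        moreover have "|G| <o |E|"
        proof -
          have "{A\<in>E. \<rho> A = i} \<subseteq> H i" using \<rho>(2) by auto
          then have "G \<subseteq> (\<lambda>A. A - U i) ` H i" using G image_mono by (metis subset_trans)
          then have "|G| \<le>o |H i|" by (rule ordLeq_transitive[OF card_of_mono1 card_of_image])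
          then show ?thesis using H_card[OF \<open>i \<in> E\<close>] by (rule ordLeq_ordLess_trans)
        qed
        ultimately show ?thesis using 1(1)[of G] by simp
      qed
    qed (rule U_def)
  qed
qed

theorem theorem1p4:
  fixes lam :: "'a rel" and k r :: nat and E :: "'a set set"
  assumes "Card_order lam" and "natLeq \<le>o lam"
    and "hypergraph E" and "E \<subseteq> omega_subsets lam"
    and "property_C r k E"
  shows "\<exists>Y. minimal_vertex_cover E Y"
proof -
  have edge: "infinite A" "countable A" if "A \<in> E" for A
  proof -
    have A: "|A| =o natLeq" using that assms(4) unfolding omega_subsets_def by blast
    then show "infinite A" unfolding ordIso_iff_ordLeq using infinite_iff_natLeq_ordLeq[of A] by blast
    show "countable A" using A unfolding countable_card_le_natLeq ordIso_iff_ordLeq by blast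
  qed
  have "\<exists>Y. private_cover E Y"
  proof (cases "r = 0")
    case True
    \<comment> \<open>For \<open>r = 0\<close> the empty subfamily applies, and its common part is
      the whole vertex set.\<close>
    then have "finite (vertices E)" using assms(5) unfolding property_C_def by force
    then have "finite A" if "A \<in> E" for A
      by (rule rev_finite_subset) (use that in \<open>auto simp: vertices_def\<close>)
    then have "E = {}" using edge(1) by blast
    then show ?thesis unfolding private_cover_def by blast
  next
    case False
    then have "0 < r" by simp
    then show ?thesis
      using private_cover_exists[OF property_C_imp_bounded_overlap[OF assms(5)]
          property_C_imp_finite_codegree[OF assms(5)]] edge by simp
  qed
  then show ?thesis using private_cover_imp_minimal_vertex_cover by blast
qed

end
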